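(* There exists a set $C$ of $333$ three-dimensional subspaces of $\mathbb{F}_2^7$ such that any two distinct members of $C$ intersect in a subspace of dimension at most $1$ (equivalently, a set of $333$ planes of $\operatorname{PG}(6,2)$ mutually intersecting in at most a point). Consequently $A_2(7,4;3)\ge 333$. Moreover, such a $C$ can be chosen so that its automorphism group $\operatorname{Aut}(C)$ is isomorphic to the Klein four-group $Z_2\times Z_2$; specifically, $\operatorname{Aut}(C)$ is the group generated by the two matrices \[ M_1=\begin{pmatrix} 0&0&1&0&0&0&0\\ 0&0&0&0&1&0&0\\ 1&0&0&0&0&0&0\\ 0&1&0&1&1&0&0\\ 0&1&0&0&0&0&0\\ 0&1&0&0&1&1&0\\ 1&0&1&1&1&0&1 \end{pmatrix},\qquad M_2=\begin{pmatrix} 1&1&0&0&0&1&0\\ 1&1&0&1&1&0&1\\ 0&1&1&0&0&1&0\\ 1&0&0&1&0&0&1\\ 1&0&0&0&1&0&1\\ 1&0&0&1&1&1&1\\ 0&1&0&0&0&1&1 \end{pmatrix} \] in $\operatorname{GL}(7,2)$.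
   Context: For subspaces $U,W$ of $\mathbb{F}_q^n$ the subspace distance is $d_S(U,W)=\dim(U+W)-\dim(U\cap W)$. $A_q(n,d;k)$ denotes the maximum cardinality of a set of $k$-dimensional subspaces of $\mathbb{F}_q^n$ with pairwise subspace distance at least $d$; for $k=3$, $d=4$ this means any two distinct members intersect in dimension at most $1$. Elements of $\mathbb{F}_2^7$ are row vectors; a matrix $M\in\operatorname{GL}(7,2)$ acts on a subspace $K$ by $K\cdot M=\{vM : v\in K\}$ (i.e. the row space of $AM$ where $A$ is a matrix whose rows span $K$). For a set $C$ of subspaces, $M$ is an automorphism of $C$ if $\{K\cdot M: K\in C\}=C$, and $\operatorname{Aut}(C)$ is the group of all automorphisms of $C$ in $\operatorname{GL}(7,2)$. *)

theory Defs
  imports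
    "HOL-Analysis.Analysis"
    "HOL-Algebra.Generated_Groups"
    "HOL-Algebra.Elementary_Groups"
    "HOL-Library.Set_Algebras"
    "HOL-Library.Z2"
begin

instance bit :: finite
proof
  have "(UNIV :: bit set) \<subseteq> {0, 1}"
    by (auto intro: bit.exhaust)
  then show "finite (UNIV :: bit set)"
    by (rule finite_subset) simp
qed


subsection \<open>Subspace codes\<close>

definition subspaces_of_dim :: "nat \<Rightarrow> ('a::field ^ 'n) set set"
  where "subspaces_of_dim k = {U. vec.subspace U \<and> vec.dim U = k}"

text \<open>\<open>U + W\<close> is the elementwise sum of sets, i.e. the sum of subspaces.\<close>

definition subspace_dist :: "('a::field ^ 'n) set \<Rightarrow> ('a ^ 'n) set \<Rightarrow> int"
  where "subspace_dist U W = int (vec.dim (U + W)) - int (vec.dim (U \<inter> W))"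

text \<open>
  The number \<open>A\<^sub>q(n, d; k)\<close>. The parameters \<open>q\<close> and \<open>n\<close> are the cardinalities of the finite
  field \<open>'a\<close> and of the index type \<open>'n\<close>, which are passed as type arguments.
\<close>

definition max_code_size ::
    "'a::{field, finite} itself \<Rightarrow> 'n::finite itself \<Rightarrow> nat \<Rightarrow> nat \<Rightarrow> nat"
  where "max_code_size TYPE('a) TYPE('n) d k =
    Max {card C | C :: ('a ^ 'n) set set.
           C \<subseteq> subspaces_of_dim k \<and> (\<forall>U\<in>C. \<forall>W\<in>C. U \<noteq> W \<longrightarrow> int d \<le> subspace_dist U W)}"

lemma max_code_size_set_finite_nonempty:
  fixes d k :: nat
  defines "S \<equiv> {card C | C :: ('a::{field, finite} ^ 'n) set set.
           C \<subseteq> subspaces_of_dim k \<and> (\<forall>U\<in>C. \<forall>W\<in>C. U \<noteq> W \<longrightarrow> int d \<le> subspace_dist U W)}"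
  shows "finite S" and "S \<noteq> {}"
proof -
  have "S \<subseteq> card ` (UNIV :: ('a ^ 'n) set set set)"
    by (auto simp: S_def)
  then show "finite S"
    by (rule finite_subset) simp
  have "card ({} :: ('a ^ 'n) set set) \<in> S"
    unfolding S_def by blast
  then show "S \<noteq> {}"
    by blast
qed


subsection \<open>Automorphism groups\<close>

definition GL :: "('a::field ^ 'n ^ 'n) monoid"
  where "GL = \<lparr>carrier = {M. invertible M}, mult = (**), one = mat 1\<rparr>"

lemma group_GL: "group (GL :: ('a::field ^ 'n ^ 'n) monoid)"
proof (rule groupI)
  fix M :: "'a ^ 'n ^ 'n"
  assume "M \<in> carrier GL"
  then obtain N where "M ** N = mat 1" "N ** M = mat 1"
    unfolding GL_def invertible_def by auto
  then show "\<exists>N\<in>carrier GL. N \<otimes>\<^bsub>GL\<^esub> M = \<one>\<^bsub>GL\<^esub>"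
    unfolding GL_def invertible_def by auto
qed (auto simp: GL_def invertible_mult matrix_mul_assoc invertible_def[of "mat 1"])

definition act :: "('a::field ^ 'n) set \<Rightarrow> 'a ^ 'n ^ 'n \<Rightarrow> ('a ^ 'n) set"
  where "act K M = (\<lambda>v. v v* M) ` K"

definition Aut :: "('a::field ^ 'n) set set \<Rightarrow> ('a ^ 'n ^ 'n) monoid"
  where "Aut C = GL\<lparr>carrier := {M \<in> carrier GL. (\<lambda>K. act K M) ` C = C}\<rparr>"

lemma act_mat_1: "act K (mat 1) = K"
  by (simp add: act_def)

lemma act_mult: "act K (M ** N) = act (act K M) N"
  by (simp add: act_def image_image vector_matrix_mul_assoc)

lemma subgroup_Aut: "subgroup (carrier (Aut C)) GL"
proof (rule group.subgroupI[OF group_GL])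
  show "carrier (Aut C) \<noteq> {}"
    using group.is_monoid[OF group_GL, THEN monoid.one_closed]
    by (auto simp: Aut_def GL_def act_mat_1)
next
  fix M N
  assume MN: "M \<in> carrier (Aut C)" "N \<in> carrier (Aut C)"
  have "(\<lambda>K. act K (M ** N)) ` C = (\<lambda>K. act K N) ` (\<lambda>K. act K M) ` C"
    by (simp add: act_mult image_image)
  with MN show "M \<otimes>\<^bsub>GL\<^esub> N \<in> carrier (Aut C)"
    by (auto simp: Aut_def GL_def invertible_mult)
next
  fix M
  assume M: "M \<in> carrier (Aut C)"
  then have M': "M \<in> carrier GL" and C: "(\<lambda>K. act K M) ` C = C"
    by (auto simp: Aut_def)
  define N where "N = inv\<^bsub>GL\<^esub> M"
  have N: "N \<in> carrier GL"
    unfolding N_def by (rule group.inv_closed[OF group_GL M'])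
  have "M \<otimes>\<^bsub>GL\<^esub> N = \<one>\<^bsub>GL\<^esub>"
    unfolding N_def by (rule group.r_inv[OF group_GL M'])
  then have MN: "M ** N = mat 1"
    by (simp add: GL_def)
  have "(\<lambda>K. act K N) ` C = (\<lambda>K. act K N) ` (\<lambda>K. act K M) ` C"
    by (simp add: C)
  also have "\<dots> = (\<lambda>K. act K (M ** N)) ` C"
    by (simp add: act_mult image_image)
  also have "\<dots> = C"
    by (simp add: MN act_mat_1)
  finally show "inv\<^bsub>GL\<^esub> M \<in> carrier (Aut C)"
    using N by (simp add: Aut_def N_def)
qed (auto simp: Aut_def)


subsection \<open>The two matrices\<close>

text \<open>
  \<^const>\<open>vector\<close> places the listed entries at the indices \<open>1, \<dots>, 7\<close> of the type \<open>7\<close>, where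
  \<open>7 = 0\<close>; the outer list is the list of rows.
\<close>

definition M1 :: "bit ^ 7 ^ 7"
  where "M1 = vector
   [vector [0,0,1,0,0,0,0],
    vector [0,0,0,0,1,0,0],
    vector [1,0,0,0,0,0,0],
    vector [0,1,0,1,1,0,0],
    vector [0,1,0,0,0,0,0],
    vector [0,1,0,0,1,1,0],
    vector [1,0,1,1,1,0,1]]"

definition M2 :: "bit ^ 7 ^ 7"
  where "M2 = vector
   [vector [1,1,0,0,0,1,0],
    vector [1,1,0,1,1,0,1],
    vector [0,1,1,0,0,1,0],
    vector [1,0,0,1,0,0,1],
    vector [1,0,0,0,1,0,1],
    vector [1,0,0,1,1,1,1],
    vector [0,1,0,0,0,1,1]]"

end

theory Submission
  imports Defs
begin

text \<open>
  The code is a union of orbits of the Klein four-group \<open>V\<close> generated by the two matrices, found by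
  computer search. Vectors are encoded as integers below 128 with addition \<open>XOR\<close>. Two codewords
  share no line because the 2331 lines in the 333 planes have distinct keys.

  That there are no further automorphisms follows from an invariant of the points: an automorphism
  \<open>M\<close> preserves the function \<open>f\<close> obtained from \<open>0\<close> by three times replacing the value at a point
  \<open>x\<close> by the sum, over the codewords through \<open>x\<close>, of a hash of the sum of the values on that
  codeword. Since \<open>M\<close> is linear, \<open>f (vM + wM) = f (v + w)\<close>, and this leaves so few possible images
  of the successive vectors of a suitable basis that a short search, in which the plane spanned by
  the first three of them must be sent to a codeword, only finds the elements of \<open>V\<close>.
\<close>

unbundle bit_operations_syntax

section \<open>Vectors over the field with two elements as integers\<close>

lemma UNIV_7: "(UNIV :: 7 set) = {1, 2, 3, 4, 5, 6, 7}"
proof -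
  have "x \<in> {1, 2, 3, 4, 5, 6, 7}" for x :: 7
  proof (induct x)
    case (of_int z)
    then have "z = 0 \<or> z = 1 \<or> z = 2 \<or> z = 3 \<or> z = 4 \<or> z = 5 \<or> z = 6"
      by fastforce
    \<comment> \<open>The residue 0 is the index 7, because \<open>7 = 0\<close> in this
      type.\<close>
    then show ?case by auto
  qed
  then show ?thesis by blast
qed

lemma forall_7: "(\<forall>i::7. P i) \<longleftrightarrow> P 1 \<and> P 2 \<and> P 3 \<and> P 4 \<and> P 5 \<and> P 6 \<and> P 7"
proof -
  have "(\<forall>i::7. P i) \<longleftrightarrow> (\<forall>i\<in>UNIV. P i)" by simp
  then show ?thesis unfolding UNIV_7 by simp
qed

lemma sum_7: "sum f (UNIV :: 7 set) = f 1 + f 2 + f 3 + f 4 + f 5 + f 6 + f 7"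
  unfolding UNIV_7 by (simp add: ac_simps)

lemma vector_7:
  "(vector [a, b, c, d, e, f, g] :: 'a::zero ^ 7) $ 1 = a"
  "(vector [a, b, c, d, e, f, g] :: 'a::zero ^ 7) $ 2 = b"
  "(vector [a, b, c, d, e, f, g] :: 'a::zero ^ 7) $ 3 = c"
  "(vector [a, b, c, d, e, f, g] :: 'a::zero ^ 7) $ 4 = d"
  "(vector [a, b, c, d, e, f, g] :: 'a::zero ^ 7) $ 5 = e"
  "(vector [a, b, c, d, e, f, g] :: 'a::zero ^ 7) $ 6 = f"
  "(vector [a, b, c, d, e, f, g] :: 'a::zero ^ 7) $ 7 = g"
  by (simp_all add: vector_def)

text \<open>Coordinate \<open>i\<close> is the binary digit of weight \<open>2\<^bsup>i - 1\<^esup>\<close>.\<close>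

definition vec_of :: "int \<Rightarrow> bit ^ 7" where
  "vec_of x = vector (map (\<lambda>i. of_bool (bit x i)) [0, 1, 2, 3, 4, 5, 6])"

lemma vec_of_nth:
  "vec_of x $ 1 = of_bool (bit x 0)" "vec_of x $ 2 = of_bool (bit x 1)"
  "vec_of x $ 3 = of_bool (bit x 2)" "vec_of x $ 4 = of_bool (bit x 3)"
  "vec_of x $ 5 = of_bool (bit x 4)" "vec_of x $ 6 = of_bool (bit x 5)"
  "vec_of x $ 7 = of_bool (bit x 6)"
  by (simp_all add: vec_of_def vector_7)

lemma vec_of_0 [simp]: "vec_of 0 = 0"
  by (simp add: vec_eq_iff forall_7 vec_of_nth)

lemma vec_of_xor: "vec_of (x XOR y) = vec_of x + vec_of y"
proof -
  have "of_bool (p \<noteq> q) = (of_bool p + of_bool q :: bit)" for p q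
    by (cases p; cases q) simp_all
  then show ?thesis
    by (simp add: vec_eq_iff forall_7 vec_of_nth bit_xor_iff)
qed

lemma xor_less_128:
  assumes "x \<in> {0..<128}" "y \<in> {0..<128::int}"
  shows "x XOR y \<in> {0..<128}"
  using assms XOR_upper[of x 7 y] by simp

lemma inj_on_vec_of: "inj_on vec_of {0..<128}"
proof (rule inj_onI)
  fix x y :: int
  assume x: "x \<in> {0..<128}" and y: "y \<in> {0..<128}" and eq: "vec_of x = vec_of y"
  have "bit x n = bit y n" if "n < 7" for n
  proof -
    have "n \<in> {0, 1, 2, 3, 4, 5, 6}"
      using that by auto
    moreover have "of_bool (bit x n) = (of_bool (bit y n) :: bit)" if "n \<in> {0, 1, 2, 3, 4, 5, 6}"
      using eq that by (auto simp: vec_eq_iff forall_7 vec_of_nth)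
    ultimately show ?thesis
      by (cases "bit x n"; cases "bit y n") simp_all
  qed
  then have "take_bit 7 x = take_bit 7 y"
    by (intro bit_eqI) (auto simp: bit_take_bit_iff)
  with x y show "x = y"
    by (simp add: take_bit_int_eq_self)
qed

text \<open>Injectivity becomes surjectivity by counting: there are \<open>2 ^ 7 = 128\<close>
  vectors.\<close>

lemma bij_betw_vec_of: "bij_betw vec_of {0..<128} UNIV"
proof -
  have "card (UNIV :: bit set) = 2"
  proof -
    have "(UNIV :: bit set) = {0, 1}"
      by (auto intro: bit.exhaust)
    then show ?thesis
      unfolding card_2_iff by (metis zero_neq_one)
  qed
  then have "card (UNIV :: (bit ^ 7) set) = 128"
    by simp
  then have "card (vec_of ` {0..<128}) = card (UNIV :: (bit ^ 7) set)"
    by (simp add: card_image[OF inj_on_vec_of])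
  then have "vec_of ` {0..<128} = UNIV"
    by (intro card_subset_eq) simp_all
  then show ?thesis
    using inj_on_vec_of by (simp add: bij_betw_def)
qed

lemma bit_vec_scale: "c *s v = (if c = 0 then 0 else v)" for c :: bit and v :: "bit ^ 'n"
  by (cases c) (simp_all add: vec_eq_iff)

lemma bit_vec_add_self [simp]: "v + v = 0" for v :: "bit ^ 'n"
  by (simp add: vec_eq_iff)

lemma bit_vec_diff: "v - w = v + w" for v w :: "bit ^ 'n"
  by (simp add: vec_eq_iff)

subsection \<open>Planes\<close>

text \<open>The points of a Fano plane in PG(6,2), given by three spanning vectors. Zero is left
  out, so that a common entry of two lists is a common point of two planes.\<close>

fun pts :: "int \<times> int \<times> int \<Rightarrow> int list" where
  "pts (a, b, c) = (let d = a XOR b in [a, b, d, c, a XOR c, b XOR c, d XOR c])"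

definition plane_of :: "int \<times> int \<times> int \<Rightarrow> (bit ^ 7) set" where
  "plane_of k = vec_of ` insert 0 (set (pts k))"

text \<open>An executable form of linear independence: a dependence over the field with two elements
  would make one of the seven nonempty sums vanish. The bound 128 keeps the encoding
  faithful.\<close>

definition nondeg :: "int \<times> int \<times> int \<Rightarrow> bool" where
  "nondeg k \<longleftrightarrow> list_all (\<lambda>x. 0 < x \<and> x < 128) (pts k) \<and> distinct (pts k)"

lemma bit_vec_span_insert:
  "vec.span (insert a S) = vec.span S \<union> (+) a ` vec.span S" for a :: "bit ^ 'n"
proof -
  have "x \<in> vec.span (insert a S) \<longleftrightarrow> x \<in> vec.span S \<or> x + a \<in> vec.span S" for x
  proof
    assume "x \<in> vec.span S \<or> x + a \<in> vec.span S"
    \<comment> \<open>The scalars 0 and 1 are spelled out to serve as witnesses for the existential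
      in \<open>vec.span_insert\<close>.\<close>
    then have "x + (if 0 = (0::bit) then 0 else a) \<in> vec.span S \<or>
        x + (if 1 = (0::bit) then 0 else a) \<in> vec.span S"
      by simp
    then show "x \<in> vec.span (insert a S)"
      unfolding vec.span_insert mem_Collect_eq bit_vec_scale bit_vec_diff by blast
  qed (auto simp: vec.span_insert bit_vec_scale bit_vec_diff split: if_splits)
  moreover have "x + a \<in> vec.span S \<longleftrightarrow> x \<in> (+) a ` vec.span S" for x
  proof
    assume "x + a \<in> vec.span S"
    then have "a + (x + a) \<in> (+) a ` vec.span S" by (rule imageI)
    moreover have "a + (x + a) = (a + a) + x" by (simp only: ac_simps)
    ultimately show "x \<in> (+) a ` vec.span S" by (simp only: bit_vec_add_self add_0_left)
  qed (auto simp: add.left_commute add.commute)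
  ultimately show ?thesis by blast
qed

text \<open>Adding one generator at a time doubles the span by a translate, which yields exactly the
  eight encoded vectors. As these are distinct, each generator lies outside the span of the previous
  ones.\<close>

lemma plane_of_subspace:
  assumes "nondeg k"
  shows "plane_of k \<in> subspaces_of_dim 3"
proof -
  obtain a b c where k: "k = (a, b, c)" by (cases k)
  let ?a = "vec_of a" and ?b = "vec_of b" and ?c = "vec_of c"
  have span: "vec.span {?b, ?a} = {0, ?a, ?b, ?a + ?b}"
    "vec.span {?a} = {0, ?a}"
    by (auto simp: bit_vec_span_insert ac_simps)
  have plane: "plane_of k = vec.span {?c, ?b, ?a}"
    unfolding k plane_of_def bit_vec_span_insert[of ?c] span
    by (auto simp: Let_def vec_of_xor ac_simps)
  have inj: "inj_on vec_of (insert 0 (set (pts k)))"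
    using assms by (intro inj_on_subset[OF inj_on_vec_of]) (auto simp: nondeg_def list_all_iff)
  have dist: "distinct (map vec_of (0 # pts k))"
    using assms inj by (auto simp: distinct_map nondeg_def list_all_iff)
  then have "vec.independent {?c, ?b, ?a}"
    unfolding vec.independent_insert span
    by (auto simp: k Let_def vec_of_xor vec.independent_insert vec.independent_empty)
  moreover have "card {?c, ?b, ?a} = 3"
    using dist by (auto simp: k Let_def)
  ultimately have "vec.dim (plane_of k) = 3"
    unfolding plane vec.dim_span by (simp add: vec.dim_eq_card_independent)
  then show ?thesis
    by (simp add: subspaces_of_dim_def plane vec.subspace_span)
qed

lemma set_pts:
  "set (pts (a, b, c)) =
    {a, b, a XOR b, c, a XOR c, b XOR c, a XOR b XOR c}"
  by (auto simp: Let_def xor.assoc)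

lemma nondeg_pts:
  assumes "nondeg k"
  shows "set (pts k) \<subseteq> {0..<128}" "0 \<notin> set (pts k)" "distinct (pts k)" "card (set (pts k)) = 7"
proof -
  show "set (pts k) \<subseteq> {0..<128}" "0 \<notin> set (pts k)" and d: "distinct (pts k)"
    using assms by (auto simp: nondeg_def list_all_iff)
  show "card (set (pts k)) = 7"
    using distinct_card[OF d] by (cases k) (simp add: Let_def)
qed

lemma plane_of_subset_iff:
  assumes "nondeg k" "nondeg k'"
  shows "plane_of k \<subseteq> plane_of k' \<longleftrightarrow> set (pts k) \<subseteq> set (pts k')"
proof -
  have "plane_of k \<subseteq> plane_of k' \<longleftrightarrow> insert 0 (set (pts k)) \<subseteq> insert 0 (set (pts k'))"
    unfolding plane_of_def
    using nondeg_pts[OF assms(1)] nondeg_pts[OF assms(2)]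
    by (intro inj_on_image_subset_iff[OF inj_on_vec_of]) auto
  also have "\<dots> \<longleftrightarrow> set (pts k) \<subseteq> set (pts k')"
    using nondeg_pts(2)[OF assms(1)] by auto
  finally show ?thesis .
qed

text \<open>The least and the greatest point of a line determine the third one as their XOR. For
  points below 128 the key, read in base 128, thus names the line, whichever two of its points are
  given.\<close>

definition line_key :: "int \<Rightarrow> int \<Rightarrow> int" where
  "line_key x y = (let z = x XOR y in 128 * min x (min y z) + max x (max y z))"

text \<open>One pair of points for each of the seven lines of the Fano plane; the pairs
  \<open>d c\<close>, \<open>a f\<close> and \<open>b e\<close> give the lines through
  \<open>a XOR b XOR c\<close>.\<close>

fun line_keys :: "int \<times> int \<times> int \<Rightarrow> int list" where
  "line_keys (a, b, c) = (let d = a XOR b; e = a XOR c; f = b XOR c in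
     [line_key a b, line_key a c, line_key b c, line_key d c, line_key a f, line_key b e,
      line_key d e])"

lemma xor_cancel [simp]:
  "x XOR (x XOR y) = y" "x XOR (y XOR x) = y" "(x XOR y) XOR x = y" "(x XOR y) XOR y = x" for x y :: int
  by (simp_all add: xor.assoc xor.commute xor.left_commute)

lemma line_key_third: "line_key x (x XOR y) = line_key x y"
  by (simp add: line_key_def Let_def min.commute max.commute)

lemma line_key_commute: "line_key x y = line_key y x"
  unfolding line_key_def Let_def
  by (simp only: xor.commute[of y x] min.left_commute[of y x] max.left_commute[of y x])

text \<open>Any two points of a Fano plane lie on one of its seven lines, and all ordered pairs of
  points on that line have the same key.\<close>

lemma line_key_in_line_keys:
  assumes "x \<in> set (pts k)" "y \<in> set (pts k)" "x \<noteq> y"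
  shows "line_key x y \<in> set (line_keys k)"
proof -
  have third: "line_key y x = line_key x y \<and> line_key x z = line_key x y \<and> line_key z x = line_key x y \<and>
      line_key y z = line_key x y \<and> line_key z y = line_key x y" if "x XOR y = z" for x y z
    using that by (metis line_key_third line_key_commute xor.commute)
  obtain a b c where k: "k = (a, b, c)" by (cases k)
  define d e f g where "d = a XOR b" and "e = a XOR c" and "f = b XOR c" and "g = d XOR c"
  note defs = this
  \<comment> \<open>The seven lines as XOR relations, from which \<open>third\<close> equates the
    keys of all pairs on each line.\<close>
  have "a XOR b = d" "a XOR c = e" "b XOR c = f" "d XOR c = g" "a XOR f = g" "b XOR e = g" "d XOR e = f"
    by (simp_all add: defs ac_simps)
  note keys = this[THEN third]
  have "set (pts k) = {a, b, d, c, e, f, g}"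
    by (simp add: k Let_def defs)
  moreover have "set (line_keys k) = {line_key a b, line_key a c, line_key b c, line_key d c,
      line_key a f, line_key b e, line_key d e}"
    by (simp add: k Let_def defs)
  ultimately show ?thesis
    using assms by (auto simp: keys)
qed

subsection \<open>Matrices\<close>

fun lin :: "int list \<Rightarrow> int \<Rightarrow> int" where
  "lin [] x = 0"
| "lin (r # rs) x = (if odd x then r else 0) XOR lin rs (x div 2)"

text \<open>Code equations that match on binary digits spare the costly evaluation of \<open>div\<close>.\<close>

lemma Pos_digits:
  "Int.Pos num.One = 1" "Int.Pos (num.Bit0 n) = 2 * Int.Pos n" "Int.Pos (num.Bit1 n) = 2 * Int.Pos n + 1"
  unfolding Int.Pos_def mult_2 by (rule numeral.simps)+

lemma lin_code [code]:
  "lin [] x = 0"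
  "lin (r # rs) 0 = lin rs 0"
  "lin (r # rs) (Int.Pos num.One) = r XOR lin rs 0"
  "lin (r # rs) (Int.Pos (num.Bit0 n)) = lin rs (Int.Pos n)"
  "lin (r # rs) (Int.Pos (num.Bit1 n)) = r XOR lin rs (Int.Pos n)"
  "lin (r # rs) (Int.Neg n) = (if odd (Int.Neg n) then r else 0) XOR lin rs (Int.Neg n div 2)"
  unfolding Pos_digits by simp_all

lemma lin_xor: "lin rs (x XOR y) = lin rs x XOR lin rs y"
proof (induction rs arbitrary: x y)
  case (Cons r rs)
  have "(x XOR y) div 2 = (x div 2) XOR (y div 2)"
    by (intro bit_eqI) (simp add: bit_xor_iff flip: bit_Suc)
  moreover have "even (x XOR y) \<longleftrightarrow> (even x \<longleftrightarrow> even y)"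
    by (simp add: even_xor_iff)
  ultimately show ?case
    by (simp add: Cons.IH ac_simps)
qed simp

definition mat_of :: "int list \<Rightarrow> bit ^ 7 ^ 7" where
  "mat_of rs = vector (map vec_of rs)"

lemma vec_times_eq_sum: "v v* M = (\<Sum>i\<in>UNIV. v $ i *s M $ i)"
  by (simp add: vec_eq_iff vector_matrix_mult_def mult.commute)

lemma vec_of_times_mat_of:
  assumes "length rs = 7"
  shows "vec_of x v* mat_of rs = vec_of (lin rs x)"
proof -
  obtain r0 r1 r2 r3 r4 r5 r6 where rs: "rs = [r0, r1, r2, r3, r4, r5, r6]"
    using assms by (auto simp: length_Suc_conv numeral_eq_Suc)
  have scale: "of_bool b *s vec_of r = vec_of (if b then r else 0)" for b r
    by (simp add: bit_vec_scale)
  have bits: "bit x 0 = odd x" "bit x 1 = odd (x div 2)" "bit x 2 = odd (x div 2 div 2)"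
      "bit x 3 = odd (x div 2 div 2 div 2)" "bit x 4 = odd (x div 2 div 2 div 2 div 2)"
      "bit x 5 = odd (x div 2 div 2 div 2 div 2 div 2)"
      "bit x 6 = odd (x div 2 div 2 div 2 div 2 div 2 div 2)"
    by (simp_all only: numeral_eq_Suc pred_numeral_simps BitM.simps One_nat_def bit_Suc bit_0)
  have lin: "lin rs x = (if bit x 0 then r0 else 0) XOR (if bit x 1 then r1 else 0) XOR
      (if bit x 2 then r2 else 0) XOR (if bit x 3 then r3 else 0) XOR
      (if bit x 4 then r4 else 0) XOR (if bit x 5 then r5 else 0) XOR (if bit x 6 then r6 else 0)"
    by (simp only: rs lin.simps bits xor.right_neutral)
  show ?thesis
    unfolding lin
    unfolding vec_of_xor vec_times_eq_sum sum_7 vec_of_nth mat_of_def rs list.map vector_7 scale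
    by (simp only: ac_simps)
qed

lemma matrix_eqI:
  assumes "\<And>x. x \<in> {0..<128} \<Longrightarrow> vec_of x v* A = vec_of x v* B"
  shows "A = B"
proof -
  have "v v* A = v v* B" for v
    using assms bij_betw_vec_of unfolding bij_betw_def by (metis UNIV_I image_iff)
  \<comment> \<open>Transposing turns the row action into the column action, to which
    \<open>matrix_eq\<close> applies.\<close>
  then have "transpose A *v v = transpose B *v v" for v
    by simp
  then have "transpose A = transpose B"
    by (simp add: matrix_eq)
  then show ?thesis
    by (metis transpose_transpose)
qed

text \<open>The first column is the lowest digit, so that the first row 0010000 of \<open>M1\<close>
  becomes 4.\<close>

definition rows1 :: "int list" where "rows1 = [4, 16, 1, 26, 2, 50, 93]"
definition rows2 :: "int list" where "rows2 = [35, 91, 38, 73, 81, 121, 98]"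

lemma M1_eq: "M1 = mat_of rows1" and M2_eq: "M2 = mat_of rows2"
  by (simp_all add: vec_eq_iff forall_7 M1_def M2_def mat_of_def rows1_def rows2_def vector_7 vec_of_nth)

lemma vec_of_times_M1: "vec_of x v* M1 = vec_of (lin rows1 x)"
  and vec_of_times_M2: "vec_of x v* M2 = vec_of (lin rows2 x)"
  by (simp_all add: M1_eq M2_eq vec_of_times_mat_of rows1_def rows2_def)

text \<open>Checking all 128 vectors makes the matrices commuting involutions, so that
  \<open>{mat 1, M1, M2, M1 ** M2}\<close> is closed under multiplication.\<close>

lemma lin_rows_involution:
  "list_all (\<lambda>x. lin rows1 (lin rows1 x) = x \<and> lin rows2 (lin rows2 x) = x \<and>
     lin rows1 (lin rows2 x) = lin rows2 (lin rows1 x)) [0..127]"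
  by code_simp

lemma M1_square: "M1 ** M1 = mat 1" and M2_square: "M2 ** M2 = mat 1"
  and M2_M1: "M2 ** M1 = M1 ** M2"
  using lin_rows_involution
  by (auto intro!: matrix_eqI
      simp: list_all_iff vec_of_times_M1 vec_of_times_M2 simp flip: vector_matrix_mul_assoc)

lemma M1_M2_in_GL: "M1 \<in> carrier GL" "M2 \<in> carrier GL" "M1 ** M2 \<in> carrier GL"
proof -
  have "invertible M1" "invertible M2"
    using M1_square M2_square by (auto simp: invertible_def)
  then show "M1 \<in> carrier GL" "M2 \<in> carrier GL" "M1 ** M2 \<in> carrier GL"
    by (simp_all add: GL_def invertible_mult)
qed

lemma M1_M2_distinct: "M1 \<noteq> mat 1" "M2 \<noteq> mat 1" "M1 \<noteq> M2" "M1 ** M2 \<noteq> mat 1"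
proof -
  have "M1 $ 1 $ 1 = 0" "M2 $ 1 $ 1 = 1" "M2 $ 1 $ 2 = 1"
    by (simp_all add: M1_def M2_def vector_7)
  then show "M1 \<noteq> mat 1" "M2 \<noteq> mat 1" and ne: "M1 \<noteq> M2"
    by (auto simp: mat_def vec_eq_iff forall_7)
  show "M1 ** M2 \<noteq> mat 1"
  proof
    assume "M1 ** M2 = mat 1"
    then have "M1 ** (M1 ** M2) = M1" by simp
    with ne show False
      by (simp add: matrix_mul_assoc M1_square)
  qed
qed

definition map_triple :: "(int \<Rightarrow> int) \<Rightarrow> int \<times> int \<times> int \<Rightarrow> int \<times> int \<times> int" where
  "map_triple f = (\<lambda>(a, b, c). (f a, f b, f c))"

lemma set_pts_map_triple: "set (pts (map_triple (lin rs) k)) = lin rs ` set (pts k)"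
  by (cases k) (simp add: map_triple_def set_pts lin_xor del: pts.simps)

lemma lin_0 [simp]: "lin rs 0 = 0"
  by (induction rs) simp_all

lemma act_plane_of:
  "act (plane_of k) M1 = plane_of (map_triple (lin rows1) k)"
  "act (plane_of k) M2 = plane_of (map_triple (lin rows2) k)"
  by (simp_all add: act_def plane_of_def image_image vec_of_times_M1 vec_of_times_M2 set_pts_map_triple)

section \<open>The code\<close>

text \<open>
  Representatives of the orbits of length four, followed by all codewords in shorter orbits, of
  the group generated by the two matrices.
\<close>

definition regular_reps :: "(int \<times> int \<times> int) list" where
  "regular_reps = [
    (1,8,20), (1,16,42), (1,26,64), (1,44,68), (1,56,72), (3,8,37), (3,16,64), (3,41,73),
    (3,53,72), (4,16,96), (4,18,104), (4,24,33), (4,27,32), (4,43,64), (4,48,90), (5,32,72),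
    (5,33,64), (6,8,96), (6,32,80), (6,35,64), (7,32,64), (8,17,71), (8,22,39), (8,48,68),
    (8,53,80), (9,16,97), (9,17,64), (9,48,80), (10,49,64), (11,19,32), (11,23,64), (12,16,32),
    (12,53,64), (13,21,96), (13,35,83), (13,55,64), (14,16,66), (14,32,69), (14,34,84),
    (14,48,64), (15,38,65), (16,33,70), (16,36,72), (16,40,69), (16,41,71), (16,47,74),
    (17,37,69), (17,47,72), (19,35,75), (20,32,65), (20,40,64), (21,32,78), (21,38,64),
    (21,41,76), (22,32,74), (22,45,70), (22,46,64), (25,32,67), (25,45,64), (26,34,74),
    (26,36,68), (28,42,66), (28,47,79), (29,44,76), (30,32,70), (30,44,64), (31,41,64),
    (31,43,79)]"

definition short_orbits :: "(int \<times> int \<times> int) list" where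
  "short_orbits = [
    (1,4,34), (2,5,89), (2,16,37), (2,32,81), (3,5,113), (3,20,36), (3,60,68), (5,8,67), (5,9,99),
    (5,10,19), (5,11,49), (5,16,65), (5,17,105), (5,18,41), (5,24,40), (5,26,73), (5,27,96),
    (6,17,40), (6,33,90), (7,18,42), (7,58,83), (8,18,32), (8,55,65), (9,23,34), (9,51,86),
    (10,18,65), (10,23,103), (10,34,70), (10,39,81), (10,48,67), (10,53,84), (12,23,33),
    (12,34,66), (13,18,34), (13,39,65), (15,18,69), (15,23,99), (15,34,71), (15,39,80),
    (15,48,66), (15,53,85), (16,34,75), (17,39,68), (20,43,72), (21,47,75), (24,34,68),
    (24,39,78), (26,37,67), (27,34,77), (29,32,68), (29,33,72), (29,34,64), (29,36,66),
    (29,37,78), (29,39,79), (29,42,75), (29,43,71), (29,46,77), (29,47,65), (30,36,78),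
    (31,39,70)]"

text \<open>There are 61 + 4 * 68 = 333 triples. The last image of each representative is the one
  under \<open>M1 ** M2\<close>, since rows are multiplied by \<open>M1\<close> first.\<close>

definition code_triples :: "(int \<times> int \<times> int) list" where
  "code_triples = short_orbits @ concat (map (\<lambda>k.
     let k1 = map_triple (lin rows1) k; k2 = map_triple (lin rows2) k
     in [k, k1, k2, map_triple (lin rows2) k1]) regular_reps)"

definition code :: "(bit ^ 7) set set" where
  "code = plane_of ` set code_triples"

section \<open>A fast test for distinctness of a list of integers\<close>

fun even_halves :: "int list \<Rightarrow> int list" where
  "even_halves [] = []"
| "even_halves (x # xs) = (if even x then x div 2 # even_halves xs else even_halves xs)"

fun odd_halves :: "int list \<Rightarrow> int list" where
  "odd_halves [] = []"
| "odd_halves (x # xs) = (if even x then odd_halves xs else x div 2 # odd_halves xs)"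

lemma even_halves_code [code]:
  "even_halves [] = []"
  "even_halves (0 # xs) = 0 # even_halves xs"
  "even_halves (Int.Pos num.One # xs) = even_halves xs"
  "even_halves (Int.Pos (num.Bit0 n) # xs) = Int.Pos n # even_halves xs"
  "even_halves (Int.Pos (num.Bit1 n) # xs) = even_halves xs"
  "even_halves (Int.Neg n # xs) =
    (if even (Int.Neg n) then Int.Neg n div 2 # even_halves xs else even_halves xs)"
  unfolding Pos_digits by simp_all

lemma odd_halves_code [code]:
  "odd_halves [] = []"
  "odd_halves (0 # xs) = odd_halves xs"
  "odd_halves (Int.Pos num.One # xs) = 0 # odd_halves xs"
  "odd_halves (Int.Pos (num.Bit0 n) # xs) = odd_halves xs"
  "odd_halves (Int.Pos (num.Bit1 n) # xs) = Int.Pos n # odd_halves xs"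
  "odd_halves (Int.Neg n # xs) =
    (if even (Int.Neg n) then odd_halves xs else Int.Neg n div 2 # odd_halves xs)"
  unfolding Pos_digits by simp_all

text \<open>The list is split by binary digits from the lowest on, so that equal entries stay
  together. This avoids comparing all pairs among thousands of keys; \<open>n\<close> is the number
  of digits that may be inspected.\<close>

primrec radix_distinct :: "nat \<Rightarrow> int list \<Rightarrow> bool" where
  "radix_distinct 0 xs \<longleftrightarrow> length xs \<le> 1"
| "radix_distinct (Suc n) xs \<longleftrightarrow>
    (case xs of [] \<Rightarrow> True | y # ys \<Rightarrow> (case ys of [] \<Rightarrow> True | _ # _ \<Rightarrow>
      radix_distinct n (even_halves xs) \<and> radix_distinct n (odd_halves xs)))"

text \<open>Halving is injective on the even and on the odd integers, so a repeated entry would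
  reappear in one of the two lists.\<close>

lemma distinct_halves:
  assumes "distinct (even_halves xs)" "distinct (odd_halves xs)"
  shows "distinct xs"
proof -
  have "x div 2 \<in> set (even_halves xs)" if "x \<in> set xs" "even x" for x xs
    using that by (induction xs) auto
  moreover have "x div 2 \<in> set (odd_halves xs)" if "x \<in> set xs" "odd x" for x xs
    using that by (induction xs) auto
  ultimately show ?thesis
    using assms by (induction xs) (auto split: if_splits)
qed

lemma radix_distinct_imp_distinct: "radix_distinct n xs \<Longrightarrow> distinct xs"
proof (induction n arbitrary: xs)
  case 0
  then show ?case by (cases xs) auto
next
  case (Suc n)
  show ?case
  proof (cases "\<exists>x y zs. xs = x # y # zs")
    case True
    then obtain x y zs where xs: "xs = x # y # zs" by blast
    have "radix_distinct n (even_halves xs) \<and> radix_distinct n (odd_halves xs)"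
      using Suc.prems by (simp only: xs radix_distinct.simps list.case)
    with Suc.IH show ?thesis
      by (blast intro: distinct_halves)
  next
    case False
    then have "xs = [] \<or> (\<exists>x. xs = [x])"
      by (metis list.exhaust)
    then show ?thesis by auto
  qed
qed

section \<open>Verification that no two codewords share a line\<close>

lemma length_code_triples: "length code_triples = 333"
  by code_simp

lemma nondeg_code_triples: "list_all nondeg code_triples"
  by code_simp

text \<open>This computation carries the distance property of the code. Depth 14 is enough because
  keys are below \<open>128 * 128 = 2 ^ 14\<close>.\<close>

lemma radix_distinct_line_keys: "radix_distinct 14 (concat (map line_keys code_triples))"
  by code_simp

lemma nondeg_in_code: "k \<in> set code_triples \<Longrightarrow> nondeg k"
  using nondeg_code_triples by (simp add: list_all_iff)

lemma distinct_code_triples: "distinct code_triples"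
  and line_keys_disjoint: "\<lbrakk>k \<in> set code_triples; k' \<in> set code_triples; i \<in> set (line_keys k);
    i \<in> set (line_keys k')\<rbrakk> \<Longrightarrow> k = k'"
proof -
  have d: "distinct (concat (map line_keys code_triples))"
    by (rule radix_distinct_imp_distinct[OF radix_distinct_line_keys])
  \<comment> \<open>\<open>distinct_concat_iff\<close> disregards empty lists, so distinctness of
    the key lists themselves requires that none is empty.\<close>
  have "line_keys k \<noteq> []" for k
    by (cases k) (simp add: Let_def)
  then have "removeAll [] (map line_keys code_triples) = map line_keys code_triples"
    by (intro removeAll_id) (metis imageE list.set_map)
  with d have dm: "distinct (map line_keys code_triples)"
    by (simp add: distinct_concat_iff)
  then have inj: "inj_on line_keys (set code_triples)"
    by (simp add: distinct_map)
  show "distinct code_triples"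
    using dm by (simp add: distinct_map)
  show "k = k'" if "k \<in> set code_triples" "k' \<in> set code_triples" "i \<in> set (line_keys k)"
    "i \<in> set (line_keys k')"
  proof (rule inj_onD[OF inj _ that(1,2)])
    show "line_keys k = line_keys k'"
      using d that by (auto simp: distinct_concat_iff)
  qed
qed

text \<open>The line through the two points lies in both planes, so its key occurs in both key
  lists.\<close>

lemma two_common_points:
  assumes "k \<in> set code_triples" "k' \<in> set code_triples"
    and "{x, y} \<subseteq> set (pts k) \<inter> set (pts k')" "x \<noteq> y"
  shows "k = k'"
  using assms by (intro line_keys_disjoint[of k k' "line_key x y"] line_key_in_line_keys) auto

lemma inj_on_set_pts: "inj_on (\<lambda>k. set (pts k)) (set code_triples)"
proof (rule inj_onI)
  fix k k'
  assume k: "k \<in> set code_triples" "k' \<in> set code_triples" and eq: "set (pts k) = set (pts k')"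
  have "\<exists>x\<in>set (pts k). \<exists>y\<in>set (pts k). x \<noteq> y"
    using nondeg_pts(3)[OF nondeg_in_code[OF k(1)]] by (cases k) (auto simp: Let_def)
  with k eq show "k = k'"
    using two_common_points by blast
qed

lemma inj_on_plane_of: "inj_on plane_of (set code_triples)"
proof (rule inj_onI)
  fix k k'
  assume k: "k \<in> set code_triples" "k' \<in> set code_triples" and "plane_of k = plane_of k'"
  then have "set (pts k) = set (pts k')"
    using plane_of_subset_iff nondeg_in_code by (metis order_refl subset_antisym)
  with k show "k = k'"
    using inj_on_set_pts by (auto dest: inj_onD)
qed

lemma code_subset: "code \<subseteq> subspaces_of_dim 3"
  by (auto simp: code_def intro: plane_of_subspace nondeg_in_code)

lemma card_code: "card code = 333"
  by (simp add: code_def card_image inj_on_plane_of distinct_card distinct_code_triples length_code_triples)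

text \<open>Two basis vectors of a larger intersection would be distinct and nonzero, hence two
  common points.\<close>

lemma code_dim_Int:
  assumes "U \<in> code" "W \<in> code" "U \<noteq> W"
  shows "vec.dim (U \<inter> W) \<le> 1"
proof (rule ccontr)
  assume "\<not> vec.dim (U \<inter> W) \<le> 1"
  moreover obtain B where B: "B \<subseteq> U \<inter> W" "vec.independent B" "card B = vec.dim (U \<inter> W)"
    using vec.basis_exists[of "U \<inter> W"] by metis
  ultimately have "2 \<le> card B" by simp
  then obtain S where "S \<subseteq> B" "card S = 2"
    using ex_card by metis
  then obtain v w where vw: "v \<in> B" "w \<in> B" "v \<noteq> w"
    unfolding card_2_iff by blast
  have nz: "v \<noteq> 0" "w \<noteq> 0"
    using vw B(2) vec.dependent_zero by auto
  obtain k k' where k: "k \<in> set code_triples" "U = plane_of k" "k' \<in> set code_triples" "W = plane_of k'"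
    using assms unfolding code_def by blast
  have *: "\<exists>x. x \<in> set (pts k) \<inter> set (pts k') \<and> u = vec_of x" if u: "u \<in> U \<inter> W" "u \<noteq> 0" for u
  proof -
    obtain x x' where x: "x \<in> set (pts k)" "u = vec_of x" "x' \<in> set (pts k')" "u = vec_of x'"
      using u unfolding k plane_of_def by auto
    moreover have "x \<in> {0..<128}" "x' \<in> {0..<128}"
      using x nondeg_pts(1)[OF nondeg_in_code[OF k(1)]] nondeg_pts(1)[OF nondeg_in_code[OF k(3)]]
      by blast+
    ultimately have "x = x'"
      using inj_onD[OF inj_on_vec_of] by metis
    with x show ?thesis by blast
  qed
  obtain x y where "x \<in> set (pts k) \<inter> set (pts k')" "v = vec_of x"
      "y \<in> set (pts k) \<inter> set (pts k')" "w = vec_of y"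
    using *[of v] *[of w] vw nz B(1) by blast
  with vw(3) have "k = k'"
    using k by (intro two_common_points[of k k' x y]) auto
  with k assms(3) show False by simp
qed

subsection \<open>The matrices are automorphisms\<close>

text \<open>Containment of the image in a codeword suffices, since both have seven points;
  \<open>plane_of_eqI\<close> makes this precise.\<close>

lemma short_orbits_closed:
  "list_all (\<lambda>k. list_ex (\<lambda>k'. list_all (\<lambda>x. x \<in> set (pts k')) (map (lin rows1) (pts k))) short_orbits \<and>
     list_ex (\<lambda>k'. list_all (\<lambda>x. x \<in> set (pts k')) (map (lin rows2) (pts k))) short_orbits) short_orbits"
  by code_simp

lemma inj_on_lin_rows: "inj_on (lin rows1) {0..<128}" "inj_on (lin rows2) {0..<128}"
  using lin_rows_involution
  by (auto simp: list_all_iff intro: inj_on_inverseI[where g = "lin rows1"] inj_on_inverseI[where g = "lin rows2"])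

lemma plane_of_eqI:
  assumes "nondeg k" "nondeg k'" "inj_on (lin rs) {0..<128}" "lin rs ` set (pts k) \<subseteq> set (pts k')"
  shows "plane_of (map_triple (lin rs) k) = plane_of k'"
proof -
  have "card (lin rs ` set (pts k)) = 7"
    using nondeg_pts[OF assms(1)] assms(3) by (metis card_image inj_on_subset)
  then have "lin rs ` set (pts k) = set (pts k')"
    using nondeg_pts(4)[OF assms(2)] assms(4) by (intro card_subset_eq) simp_all
  then show ?thesis
    by (simp add: plane_of_def set_pts_map_triple)
qed

text \<open>In this form, closure of the long orbits reduces to closure of the four matrices under
  right multiplication.\<close>

lemma mem_code_iff:
  "K \<in> code \<longleftrightarrow> (\<exists>k\<in>set short_orbits. K = plane_of k) \<or>
    (\<exists>k\<in>set regular_reps. \<exists>g\<in>{mat 1, M1, M2, M1 ** M2}. K = act (plane_of k) g)"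
  by (auto simp: code_def code_triples_def Let_def act_plane_of act_mat_1 act_mult)

lemma act_short_orbits:
  assumes "k \<in> set short_orbits" "g \<in> {M1, M2}"
  shows "\<exists>k'\<in>set short_orbits. act (plane_of k) g = plane_of k'"
proof -
  have nd: "nondeg k'" if "k' \<in> set short_orbits" for k'
    using that nondeg_in_code by (simp add: code_triples_def)
  have "\<exists>k'\<in>set short_orbits. lin rows1 ` set (pts k) \<subseteq> set (pts k')"
    "\<exists>k'\<in>set short_orbits. lin rows2 ` set (pts k) \<subseteq> set (pts k')"
    using short_orbits_closed assms(1)
    by (simp_all add: list_all_iff list_ex_iff image_subset_iff del: pts.simps)
  then show ?thesis
    using assms(2) plane_of_eqI[OF nd[OF assms(1)] nd] inj_on_lin_rows by (auto simp: act_plane_of)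
qed

lemma act_code:
  assumes "K \<in> code" "g \<in> {M1, M2}"
  shows "act K g \<in> code"
proof -
  \<comment> \<open>These rules cancel squares and move \<open>M1\<close> to the left, which brings
    every product into one of the four forms.\<close>
  have [simp]: "M1 ** (M1 ** A) = A" "M2 ** (M2 ** A) = A" "M2 ** (M1 ** A) = M1 ** (M2 ** A)" for A
    by (simp_all add: matrix_mul_assoc M1_square M2_square M2_M1)
  have "h ** g \<in> {mat 1, M1, M2, M1 ** M2}" if "h \<in> {mat 1, M1, M2, M1 ** M2}" for h
    using that assms(2) by (auto simp: M1_square M2_square M2_M1 simp flip: matrix_mul_assoc)
  moreover have "act (act (plane_of k) h) g = act (plane_of k) (h ** g)" for k h
    by (simp add: act_mult)
  ultimately show ?thesis
    using assms act_short_orbits unfolding mem_code_iff by blast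
qed

lemma M1_M2_in_Aut: "M1 \<in> carrier (Aut code)" "M2 \<in> carrier (Aut code)"
proof -
  have "g \<in> carrier (Aut code)" if g: "g \<in> {M1, M2}" for g
  proof -
    \<comment> \<open>As \<open>g\<close> is an involution, mapping \<open>code\<close> into itself
      already makes it map onto \<open>code\<close>.\<close>
    have "act (act K g) g = K" for K
      using g M1_square M2_square by (auto simp: act_mat_1 simp flip: act_mult)
    then have "(\<lambda>K. act K g) ` code = code"
      using act_code[OF _ g] by (metis image_eqI image_subsetI subsetI subset_antisym)
    then show ?thesis
      using g M1_M2_in_GL by (auto simp: Aut_def)
  qed
  then show "M1 \<in> carrier (Aut code)" "M2 \<in> carrier (Aut code)"
    by simp_all
qed

lemma mult_in_Aut:
  assumes "A \<in> carrier (Aut C)" "B \<in> carrier (Aut C)"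
  shows "A ** B \<in> carrier (Aut C)"
  using subgroup.m_closed[OF subgroup_Aut assms] by (simp add: GL_def)

section \<open>An invariant of the points\<close>

definition code_points :: "int set set" where
  "code_points = (\<lambda>k. set (pts k)) ` set code_triples"

text \<open>An automorphism transported to encodings. All conditions are confined to
  \<open>{0..<128}\<close>, where \<open>vec_of\<close> is a bijection.\<close>

definition preserves_code :: "(int \<Rightarrow> int) \<Rightarrow> bool" where
  "preserves_code m \<longleftrightarrow> m ` {0..<128} \<subseteq> {0..<128} \<and> inj_on m {0..<128} \<and>
    (\<forall>x\<in>{0..<128}. \<forall>y\<in>{0..<128}. m (x XOR y) = m x XOR m y) \<and> (`) m ` code_points = code_points"

lemma code_points_subset: "K \<in> code_points \<Longrightarrow> K \<subseteq> {0..<128}"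
  unfolding code_points_def using nondeg_pts(1) nondeg_in_code by blast

lemma code_eq_code_points: "code = (\<lambda>K. vec_of ` insert 0 K) ` code_points"
  by (simp add: code_def code_points_def image_image plane_of_def)

lemma ex_preserves_code:
  assumes M: "M \<in> carrier (Aut code)"
  obtains m where "preserves_code m" "\<And>x. x \<in> {0..<128} \<Longrightarrow> vec_of x v* M = vec_of (m x)"
proof -
  \<comment> \<open>The matrix action conjugated by the bijection \<open>vec_of\<close>.\<close>
  define m where "m x = the_inv_into {0..<128} vec_of (vec_of x v* M)" for x
  have vm: "vec_of (m x) = vec_of x v* M" for x
    using f_the_inv_into_f_bij_betw[OF bij_betw_vec_of] by (simp add: m_def)
  have m_less: "m x \<in> {0..<128}" for x
    using bij_betw_vec_of the_inv_into_into[OF inj_on_vec_of, of _ "{0..<128}"]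
    by (simp add: m_def bij_betw_def)
  have eqI: "x = y" if "vec_of x = vec_of y" "x \<in> {0..<128}" "y \<in> {0..<128}" for x y
    using that inj_on_vec_of by (auto dest: inj_onD)
  have add: "m (x XOR y) = m x XOR m y" for x y
    by (rule eqI) (simp_all only: vm vec_of_xor vector_matrix_left_distrib m_less xor_less_128)
  obtain N where N: "M ** N = mat 1"
    using M by (auto simp: Aut_def GL_def invertible_def)
  have inj: "inj_on m {0..<128}"
  proof (rule inj_onI)
    fix x y :: int
    assume xy: "x \<in> {0..<128}" "y \<in> {0..<128}" and "m x = m y"
    then have "vec_of x v* M = vec_of y v* M"
      by (metis vm)
    then have "vec_of x v* (M ** N) = vec_of y v* (M ** N)"
      by (metis vector_matrix_mul_assoc)
    with xy show "x = y"
      by (simp add: N eqI)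
  qed
  have m0: "m 0 = 0"
    using add[of 0 0] by simp
  have act: "act (vec_of ` insert 0 K) M = vec_of ` insert 0 (m ` K)" for K
    by (simp add: act_def image_image vm)
  have img: "insert 0 K = insert 0 K'"
    if "vec_of ` insert 0 K = vec_of ` insert 0 K'" "K \<subseteq> {0..<128}" "K' \<subseteq> {0..<128}" for K K'
    using that by (intro inj_on_image_eq_iff[OF inj_on_vec_of, THEN iffD1]) auto
  have zero: "0 \<notin> K" if "K \<in> code_points" for K
    using that nondeg_pts(2) nondeg_in_code unfolding code_points_def by blast
  have zero': "0 \<notin> m ` K" if "K \<in> code_points" for K
  proof
    assume "0 \<in> m ` K"
    then obtain x where "x \<in> K" "m x = m 0" by (auto simp: m0)
    with inj code_points_subset[OF that] have "0 \<in> K"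
      by (metis inj_on_contraD atLeastLessThan_iff order_refl subsetD zero_less_numeral)
    with zero[OF that] show False by blast
  qed
  have act_code: "(\<lambda>K. act K M) ` code = code"
    using M by (auto simp: Aut_def)
  have "(\<lambda>K. vec_of ` insert 0 K) ` ((`) m ` code_points) = (\<lambda>K. vec_of ` insert 0 K) ` code_points"
    using act_code by (simp add: code_eq_code_points image_image act del: image_insert)
  \<comment> \<open>No member of \<open>code_points\<close> contains zero, nor does its image under
    \<open>m\<close>, so the inserted zero can be cancelled on both sides.\<close>
  moreover have "inj_on (\<lambda>K. vec_of ` insert 0 K) {K. K \<subseteq> {0..<128} \<and> 0 \<notin> K}"
    using img by (intro inj_onI) (blast dest: insert_ident[THEN iffD1, rotated 2])
  moreover have "(`) m ` code_points \<subseteq> {K. K \<subseteq> {0..<128} \<and> 0 \<notin> K}"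
    using zero' m_less by (auto simp: image_subset_iff)
  moreover have "code_points \<subseteq> {K. K \<subseteq> {0..<128} \<and> 0 \<notin> K}"
    using zero code_points_subset by auto
  ultimately have "(`) m ` code_points = code_points"
    by (simp add: inj_on_image_eq_iff)
  then have "preserves_code m"
    using m_less inj add by (auto simp: preserves_code_def)
  then show ?thesis
    using vm by (metis that)
qed

text \<open>Chosen to keep the numbers small while still separating enough points.\<close>

definition hash :: "int \<Rightarrow> int" where
  "hash s = s * s mod 7"

text \<open>One refinement round. Because of the summand 1, the round starting from the zero
  function counts the codewords through each point, as \<open>hash 1 = 1\<close>.\<close>

definition point_sum :: "(int \<Rightarrow> int) \<Rightarrow> int \<Rightarrow> int" where
  "point_sum f x = (\<Sum>K\<in>code_points. if x \<in> K then hash (1 + sum f K) else 0)"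

text \<open>Since \<open>m\<close> permutes the codewords, the sum can be reindexed along
  \<open>m\<close>; incidence and the sums over codewords are unchanged.\<close>

lemma point_sum_invariant:
  assumes m: "preserves_code m" and f: "\<And>x. x \<in> {0..<128} \<Longrightarrow> f (m x) = f x"
    and x: "x \<in> {0..<128}"
  shows "point_sum f (m x) = point_sum f x"
proof -
  have inj: "inj_on m {0..<128}" and cp: "(`) m ` code_points = code_points"
    using m by (auto simp: preserves_code_def)
  have "inj_on ((`) m) code_points"
    by (rule inj_onI) (use inj code_points_subset in \<open>auto simp: inj_on_image_eq_iff\<close>)
  then have "point_sum f (m x) = (\<Sum>K\<in>code_points. if m x \<in> m ` K then hash (1 + sum f (m ` K)) else 0)"
    unfolding point_sum_def by (subst cp[symmetric]) (simp only: sum.reindex o_def)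
  also have "\<dots> = point_sum f x"
    unfolding point_sum_def
  proof (rule sum.cong[OF refl])
    fix K
    assume K: "K \<in> code_points"
    note sub = code_points_subset[OF K]
    have "sum f (m ` K) = (\<Sum>y\<in>K. f (m y))"
      using inj_on_subset[OF inj sub] by (simp add: sum.reindex)
    also have "\<dots> = sum f K"
      using sub by (intro sum.cong) (auto intro: f)
    finally show "(if m x \<in> m ` K then hash (1 + sum f (m ` K)) else 0) =
        (if x \<in> K then hash (1 + sum f K) else 0)"
      using inj_on_image_mem_iff[OF inj x sub] by simp
  qed
  finally show ?thesis .
qed

subsection \<open>Evaluation\<close>

text \<open>Binary tries with the lowest digit at the root, holding functions on encoded vectors in
  a form suited to symbolic evaluation.\<close>

datatype table = Leaf int | Node table table

fun lookup :: "table \<Rightarrow> int \<Rightarrow> int" where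
  "lookup (Leaf c) x = c"
| "lookup (Node l r) x = (if even x then lookup l (x div 2) else lookup r (x div 2))"

lemma lookup_code [code]:
  "lookup (Leaf c) x = c"
  "lookup (Node l r) 0 = lookup l 0"
  "lookup (Node l r) (Int.Pos num.One) = lookup r 0"
  "lookup (Node l r) (Int.Pos (num.Bit0 n)) = lookup l (Int.Pos n)"
  "lookup (Node l r) (Int.Pos (num.Bit1 n)) = lookup r (Int.Pos n)"
  "lookup (Node l r) (Int.Neg n) =
    (if even (Int.Neg n) then lookup l (Int.Neg n div 2) else lookup r (Int.Neg n div 2))"
  unfolding Pos_digits by simp_all

fun increase :: "int \<Rightarrow> int \<Rightarrow> table \<Rightarrow> table" where
  "increase x d (Leaf c) = Leaf (d + c)"
| "increase x d (Node l r) =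
    (if even x then Node (increase (x div 2) d l) r else Node l (increase (x div 2) d r))"

lemma increase_code [code]:
  "increase x d (Leaf c) = Leaf (d + c)"
  "increase 0 d (Node l r) = Node (increase 0 d l) r"
  "increase (Int.Pos num.One) d (Node l r) = Node l (increase 0 d r)"
  "increase (Int.Pos (num.Bit0 n)) d (Node l r) = Node (increase (Int.Pos n) d l) r"
  "increase (Int.Pos (num.Bit1 n)) d (Node l r) = Node l (increase (Int.Pos n) d r)"
  "increase (Int.Neg n) d (Node l r) = (if even (Int.Neg n)
    then Node (increase (Int.Neg n div 2) d l) r else Node l (increase (Int.Neg n div 2) d r))"
  unfolding Pos_digits by simp_all

primrec zero_table :: "nat \<Rightarrow> table" where
  "zero_table 0 = Leaf 0"
| "zero_table (Suc n) = Node (zero_table n) (zero_table n)"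

text \<open>At uniform depth \<open>n\<close>, distinct keys below \<open>2 ^ n\<close> reach
  distinct leaves; \<open>lookup_increase\<close> relies on this.\<close>

fun complete :: "nat \<Rightarrow> table \<Rightarrow> bool" where
  "complete 0 (Leaf c) \<longleftrightarrow> True"
| "complete (Suc n) (Node l r) \<longleftrightarrow> complete n l \<and> complete n r"
| "complete _ _ \<longleftrightarrow> False"

lemma complete_zero_table: "complete n (zero_table n)"
  by (induction n) auto

lemma lookup_zero_table: "lookup (zero_table n) x = 0"
  by (induction n arbitrary: x) auto

lemma complete_increase: "complete n t \<Longrightarrow> complete n (increase x d t)"
  by (induction n t arbitrary: x rule: complete.induct) auto

lemma lookup_increase:
  assumes "complete n t" "x \<in> {0..<2 ^ n}" "y \<in> {0..<2 ^ n}"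
  shows "lookup (increase x d t) y = lookup t y + (if x = y then d else 0)"
  using assms
proof (induction n t arbitrary: x y rule: complete.induct)
  case (2 n l r)
  have "x div 2 \<in> {0..<2 ^ n}" "y div 2 \<in> {0..<2 ^ n}"
    using 2 by auto
  moreover have "x = y \<longleftrightarrow> (even x \<longleftrightarrow> even y) \<and> x div 2 = y div 2"
    by presburger
  ultimately show ?case
    using 2 by auto
qed auto

primrec increase_all :: "int list \<Rightarrow> int \<Rightarrow> table \<Rightarrow> table" where
  "increase_all [] d t = t"
| "increase_all (x # xs) d t = increase_all xs d (increase x d t)"

lemma complete_increase_all: "complete n t \<Longrightarrow> complete n (increase_all xs d t)"
  by (induction xs arbitrary: t) (auto intro: complete_increase)

lemma lookup_increase_all:
  assumes "complete n t" "set xs \<subseteq> {0..<2 ^ n}" "distinct xs" "y \<in> {0..<2 ^ n}"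
  shows "lookup (increase_all xs d t) y = lookup t y + (if y \<in> set xs then d else 0)"
  using assms
proof (induction xs arbitrary: t)
  case (Cons x xs)
  then show ?case
    using lookup_increase[of n t x y d] complete_increase[of n t x d] by auto
qed simp

text \<open>The sum in \<open>point_sum\<close> is computed codeword by codeword: each hash is
  evaluated once and then distributed to the seven points.\<close>

definition add_plane :: "table \<Rightarrow> int list \<Rightarrow> table \<Rightarrow> table" where
  "add_plane F ps t = increase_all ps (hash (1 + sum_list (map (lookup F) ps))) t"

primrec add_planes :: "(int \<times> int \<times> int) list \<Rightarrow> table \<Rightarrow> table \<Rightarrow> table" where
  "add_planes [] F t = t"
| "add_planes (k # ks) F t = add_planes ks F (add_plane F (pts k) t)"

lemma lookup_add_planes:
  assumes "complete 7 t" "\<And>k. k \<in> set ks \<Longrightarrow> nondeg k" "x \<in> {0..<128}"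
  shows "lookup (add_planes ks F t) x = lookup t x +
    (\<Sum>k\<leftarrow>ks. if x \<in> set (pts k) then hash (1 + sum (lookup F) (set (pts k))) else 0)"
  using assms
proof (induction ks arbitrary: t)
  case (Cons k ks)
  have d: "distinct (pts k)" and s: "set (pts k) \<subseteq> {0..<128}"
    using nondeg_pts Cons.prems by auto
  have "lookup (add_plane F (pts k) t) x = lookup t x +
      (if x \<in> set (pts k) then hash (1 + sum (lookup F) (set (pts k))) else 0)"
    using Cons.prems d s
    by (simp add: add_plane_def lookup_increase_all[of 7] sum_list_distinct_conv_sum_set del: pts.simps)
  moreover have "complete 7 (add_plane F (pts k) t)"
    using Cons.prems by (simp add: add_plane_def complete_increase_all)
  ultimately show ?case
    using Cons.IH[of "add_plane F (pts k) t"] Cons.prems by (simp del: pts.simps)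
qed simp

definition point_sum_table :: "(int \<times> int \<times> int) list \<Rightarrow> table \<Rightarrow> table" where
  "point_sum_table ks F = add_planes ks F (zero_table 7)"

lemma lookup_point_sum_table:
  assumes "x \<in> {0..<128}"
  shows "lookup (point_sum_table code_triples F) x = point_sum (lookup F) x"
proof -
  have "lookup (point_sum_table code_triples F) x =
      (\<Sum>k\<leftarrow>code_triples. if x \<in> set (pts k) then hash (1 + sum (lookup F) (set (pts k))) else 0)"
    using assms unfolding point_sum_table_def
    by (subst lookup_add_planes) (simp_all add: complete_zero_table lookup_zero_table nondeg_in_code)
  also have "\<dots> = point_sum (lookup F) x"
    unfolding point_sum_def code_points_def
    by (simp add: sum.reindex[OF inj_on_set_pts] sum_list_distinct_conv_sum_set distinct_code_triples
        del: pts.simps)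
  finally show ?thesis .
qed

definition invariant :: "table \<Rightarrow> bool" where
  "invariant F \<longleftrightarrow> (\<forall>m. preserves_code m \<longrightarrow> (\<forall>x\<in>{0..<128}. lookup F (m x) = lookup F x))"

lemma invariant_zero_table: "invariant (zero_table n)"
  by (simp add: invariant_def lookup_zero_table)

lemma invariant_point_sum_table:
  assumes "invariant F"
  shows "invariant (point_sum_table code_triples F)"
  unfolding invariant_def
proof (intro allI impI ballI)
  fix m and x :: int
  assume m: "preserves_code m" and x: "x \<in> {0..<128}"
  then have "m x \<in> {0..<128}"
    unfolding preserves_code_def by blast
  then show "lookup (point_sum_table code_triples F) (m x) = lookup (point_sum_table code_triples F) x"
    using m x assms point_sum_invariant[of m "lookup F" x]
    by (simp add: lookup_point_sum_table invariant_def)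
qed

section \<open>Determination of the automorphism group\<close>

text \<open>
  A linear map preserving an invariant is reconstructed basis vector by basis vector: \<open>xs\<close> lists
  the span of the basis vectors treated so far, and each list in \<open>imgs\<close> is a candidate for its
  pointwise image.
\<close>

primrec span_list :: "int list \<Rightarrow> int list \<Rightarrow> int list" where
  "span_list [] xs = xs"
| "span_list (b # bs) xs = span_list bs (xs @ map ((XOR) b) xs)"

text \<open>By linearity, the image \<open>w\<close> of the new basis vector forces the images
  \<open>map ((XOR) w) ys\<close> on the new coset; \<open>vals\<close> lists the values that these
  must have.\<close>

definition extensions :: "table \<Rightarrow> int list \<Rightarrow> int list \<Rightarrow> int list \<Rightarrow> int list list" where
  "extensions F vals ws ys = map (\<lambda>zs. ys @ zs)
    (filter (\<lambda>zs. map (lookup F) zs = vals) (map (\<lambda>w. map ((XOR) w) ys) ws))"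

text \<open>Comparing values at \<open>b\<close> first thins out the candidates \<open>w\<close>
  before whole cosets are formed.\<close>

definition extend_images :: "table \<Rightarrow> int \<Rightarrow> int list \<Rightarrow> int list list \<Rightarrow> int list list" where
  "extend_images F b xs imgs = concat (map (extensions F (map (lookup F) (map ((XOR) b) xs))
    (filter (\<lambda>w. lookup F w = lookup F b) [0..127])) imgs)"

primrec images :: "table \<Rightarrow> int list \<Rightarrow> int list \<Rightarrow> int list list \<Rightarrow> int list list" where
  "images F [] xs imgs = imgs"
| "images F (b # bs) xs imgs = images F bs (xs @ map ((XOR) b) xs) (extend_images F b xs imgs)"

text \<open>\<open>tl\<close> drops the zero vector, which heads the span lists and is absent from
  \<open>pts\<close>.\<close>

definition in_codeword :: "(int \<times> int \<times> int) list \<Rightarrow> int list \<Rightarrow> bool" where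
  "in_codeword ks xs = list_ex (\<lambda>k. list_all (\<lambda>x. x \<in> set (pts k)) (tl xs)) ks"

lemma set_span_list:
  assumes "set xs \<subseteq> {0..<128}" "set bs \<subseteq> {0..<128}"
  shows "set (span_list bs xs) \<subseteq> {0..<128}"
  using assms
proof (induction bs arbitrary: xs)
  case (Cons b bs)
  then have "(XOR) b ` set xs \<subseteq> {0..<128}"
    by (intro image_subsetI xor_less_128) auto
  with Cons show ?case by simp
qed simp

text \<open>Completeness of a search step: an actual automorphism passes every test, because
  \<open>F\<close> is constant along it.\<close>

lemma map_in_extend_images:
  assumes F: "invariant F" and m: "preserves_code m"
    and xs: "set xs \<subseteq> {0..<128}" "b \<in> {0..<128}" and imgs: "map m xs \<in> set imgs"
  shows "map m (xs @ map ((XOR) b) xs) \<in> set (extend_images F b xs imgs)"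
proof -
  have inv: "lookup F (m x) = lookup F x" if "x \<in> {0..<128}" for x
    using F m that by (auto simp: invariant_def)
  have mb: "m b \<in> {0..<128}"
    using m xs(2) unfolding preserves_code_def by blast
  have shift: "map ((XOR) (m b)) (map m xs) = map m (map ((XOR) b) xs)"
    using m xs by (auto simp: preserves_code_def)
  have "map (lookup F) (map m (map ((XOR) b) xs)) = map (lookup F) (map ((XOR) b) xs)"
    using xs inv xor_less_128[OF xs(2)] by (auto intro!: inv)
  then have "map m (xs @ map ((XOR) b) xs) \<in> set (extensions F (map (lookup F) (map ((XOR) b) xs))
      (filter (\<lambda>w. lookup F w = lookup F b) [0..127]) (map m xs))"
    unfolding extensions_def set_map set_filter
    using mb inv[OF xs(2)]
    by (intro image_eqI[where x = "map m (map ((XOR) b) xs)"] CollectI conjI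
        image_eqI[where x = "m b"]) (simp_all only: map_append shift, auto)
  then show ?thesis
    using imgs unfolding extend_images_def set_concat set_map by blast
qed

lemma map_in_images:
  assumes "invariant F" "preserves_code m"
    and "set xs \<subseteq> {0..<128}" "set bs \<subseteq> {0..<128}" "map m xs \<in> set imgs"
  shows "map m (span_list bs xs) \<in> set (images F bs xs imgs)"
  using assms(3-)
proof (induction bs arbitrary: xs imgs)
  case (Cons b bs)
  have "map m (xs @ map ((XOR) b) xs) \<in> set (extend_images F b xs imgs)"
    using Cons.prems by (intro map_in_extend_images assms(1,2)) auto
  moreover have "set (xs @ map ((XOR) b) xs) \<subseteq> {0..<128}"
    using set_span_list[of xs "[b]"] Cons.prems by simp
  ultimately show ?case
    using Cons.IH[of "xs @ map ((XOR) b) xs" "extend_images F b xs imgs"] Cons.prems by simp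
qed simp

lemma map_in_codeword:
  assumes m: "preserves_code m" and xs: "in_codeword code_triples xs" "xs \<noteq> []"
  shows "in_codeword code_triples (map m xs)"
proof -
  obtain k where k: "k \<in> set code_triples" "set (tl xs) \<subseteq> set (pts k)"
    using xs(1) by (auto simp: in_codeword_def list_ex_iff list_all_iff)
  have "m ` set (pts k) \<in> code_points"
    using m k(1) unfolding preserves_code_def code_points_def by blast
  then obtain k' where k': "k' \<in> set code_triples" "m ` set (pts k) = set (pts k')"
    by (auto simp: code_points_def)
  have "m ` set (tl xs) \<subseteq> set (pts k')"
    using k(2) k'(2) by blast
  then show ?thesis
    using k'(1) by (auto simp: in_codeword_def list_ex_iff list_all_iff map_tl[symmetric] image_subset_iff)
qed

text \<open>These three vectors span a codeword, which permits pruning by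
  \<open>in_codeword\<close>; \<open>basis2\<close> completes them to a basis of the whole space, as
  \<open>span_list_basis\<close> confirms.\<close>

definition basis1 :: "int list" where "basis1 = [53, 113, 35]"
definition basis2 :: "int list" where "basis2 = [9, 39, 40, 102]"

definition search :: "(int \<times> int \<times> int) list \<Rightarrow> table \<Rightarrow> int list list" where
  "search ks F = images F basis2 (span_list basis1 [0])
    (filter (in_codeword ks) (images F basis1 [0] [[0]]))"

text \<open>Three refinement rounds separate the points well enough that every surviving candidate
  is the action of one of the four matrices on the whole space.\<close>

lemma search_result:
  "list_all (\<lambda>ys. ys \<in> set (map (\<lambda>g. map g (span_list basis2 (span_list basis1 [0])))
      [\<lambda>x. x, lin rows1, lin rows2, \<lambda>x. lin rows2 (lin rows1 x)]))
    (search code_triples (point_sum_table code_triples (point_sum_table code_triples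
      (point_sum_table code_triples (zero_table 7)))))"
  by code_simp

lemma span_list_basis: "list_all (\<lambda>x. x \<in> set (span_list basis2 (span_list basis1 [0]))) [0..127]"
  by code_simp

lemma in_codeword_basis1: "in_codeword code_triples (span_list basis1 [0])"
  by code_simp

lemma preserves_code_cases:
  assumes m: "preserves_code m"
  obtains g where "g \<in> {\<lambda>x. x, lin rows1, lin rows2, \<lambda>x. lin rows2 (lin rows1 x)}"
    and "\<And>x. x \<in> {0..<128} \<Longrightarrow> m x = g x"
proof -
  let ?F = "point_sum_table code_triples (point_sum_table code_triples
      (point_sum_table code_triples (zero_table 7)))"
  let ?xs = "span_list basis2 (span_list basis1 [0])"
  have F: "invariant ?F"
    by (intro invariant_point_sum_table invariant_zero_table)
  have "(0 :: int) \<in> {0..<128}" by simp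
  then have "m (0 XOR 0) = m 0 XOR m 0"
    using m unfolding preserves_code_def by blast
  then have m0: "m 0 = 0" by simp
  have b: "set basis1 \<subseteq> {0..<128}" "set basis2 \<subseteq> {0..<128}"
    by (simp_all add: basis1_def basis2_def)
  have "map m (span_list basis1 [0]) \<in> set (images ?F basis1 [0] [[0]])"
    using b m0 by (intro map_in_images F m) auto
  moreover have "span_list basis1 [0] \<noteq> []"
    by (simp add: basis1_def)
  ultimately have "map m ?xs \<in> set (search code_triples ?F)"
    unfolding search_def using b
    by (intro map_in_images F m set_span_list) (auto intro: map_in_codeword m in_codeword_basis1)
  then have "map m ?xs \<in> set (map (\<lambda>g. map g ?xs)
      [\<lambda>x. x, lin rows1, lin rows2, \<lambda>x. lin rows2 (lin rows1 x)])"
    using search_result unfolding list_all_iff by blast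
  then obtain g where g: "g \<in> {\<lambda>x. x, lin rows1, lin rows2, \<lambda>x. lin rows2 (lin rows1 x)}"
    "map m ?xs = map g ?xs"
    unfolding set_map list.set by blast
  have "m x = g x" if "x \<in> {0..<128}" for x
  proof -
    have "x \<in> set ?xs"
      using span_list_basis that by (simp add: list_all_iff)
    with g(2) show ?thesis by (simp only: map_eq_conv)
  qed
  with g(1) show ?thesis by (rule that)
qed

lemma carrier_Aut_code: "carrier (Aut code) = {mat 1, M1, M2, M1 ** M2}"
proof
  show "{mat 1, M1, M2, M1 ** M2} \<subseteq> carrier (Aut code)"
    using M1_M2_in_Aut mult_in_Aut subgroup.one_closed[OF subgroup_Aut, of code]
    by (auto simp: GL_def)
  show "carrier (Aut code) \<subseteq> {mat 1, M1, M2, M1 ** M2}"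
  proof
    fix M
    assume "M \<in> carrier (Aut code)"
    then obtain m where m: "preserves_code m" "\<And>x. x \<in> {0..<128} \<Longrightarrow> vec_of x v* M = vec_of (m x)"
      by (rule ex_preserves_code) blast
    obtain g where g: "g \<in> {\<lambda>x. x, lin rows1, lin rows2, \<lambda>x. lin rows2 (lin rows1 x)}"
      "\<And>x. x \<in> {0..<128} \<Longrightarrow> m x = g x"
      by (rule preserves_code_cases[OF m(1)]) blast
    have "vec_of x v* M = vec_of (g x)" if "x \<in> {0..<128}" for x
      using m(2)[OF that] g(2)[OF that] by simp
    moreover have "vec_of x v* (M1 ** M2) = vec_of (lin rows2 (lin rows1 x))" for x
      by (simp add: vec_of_times_M1 vec_of_times_M2 flip: vector_matrix_mul_assoc)
    ultimately show "M \<in> {mat 1, M1, M2, M1 ** M2}"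
      using g(1) by (auto intro!: matrix_eqI simp: vec_of_times_M1 vec_of_times_M2)
  qed
qed

section \<open>Structure of the automorphism group\<close>

lemma generate_eq: "generate GL {M1, M2} = {mat 1, M1, M2, M1 ** M2}"
proof
  \<comment> \<open>The subgroup property is inherited from the automorphism group, whose carrier is
    this set.\<close>
  have "subgroup {mat 1, M1, M2, M1 ** M2} GL"
    using subgroup_Aut[of code] by (simp add: carrier_Aut_code)
  then show "generate GL {M1, M2} \<subseteq> {mat 1, M1, M2, M1 ** M2}"
    by (intro group.generate_subgroup_incl[OF group_GL]) auto
  have "mat 1 \<in> generate GL {M1, M2}"
    using generate.one[of GL "{M1, M2}"] by (simp add: GL_def)
  moreover have "M1 ** M2 \<in> generate GL {M1, M2}"
    using generate.eng[of M1 GL "{M1, M2}" M2] by (simp add: GL_def generate.incl)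
  ultimately show "{mat 1, M1, M2, M1 ** M2} \<subseteq> generate GL {M1, M2}"
    by (auto intro: generate.incl)
qed

lemma Aut_code_iso: "Aut code \<cong> integer_mod_group 2 \<times>\<times> integer_mod_group 2"
proof -
  let ?Z = "integer_mod_group 2 \<times>\<times> integer_mod_group 2"
  \<comment> \<open>The pair of exponents of \<open>M1\<close> and \<open>M2\<close>; addition
    modulo 2 is respected because the matrices are commuting involutions.\<close>
  define h :: "int \<times> int \<Rightarrow> bit ^ 7 ^ 7" where
    "h = (\<lambda>(i, j). (if i = 0 then mat 1 else M1) ** (if j = 0 then mat 1 else M2))"
  have Z: "carrier ?Z = {(0, 0), (0, 1), (1, 0), (1, 1)}"
    by (auto simp: carrier_integer_mod_group)
  have mult: "x \<otimes>\<^bsub>Aut code\<^esub> y = x ** y" for x y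
    by (simp add: Aut_def GL_def)
  have [simp]: "M1 ** (M1 ** A) = A" "M2 ** (M2 ** A) = A" "M2 ** (M1 ** A) = M1 ** (M2 ** A)" for A
    by (simp_all add: matrix_mul_assoc M1_square M2_square M2_M1)
  note [simp] = M1_square M2_square M2_M1
  have "M1 ** M2 \<noteq> M1" "M1 ** M2 \<noteq> M2"
  proof -
    show "M1 ** M2 \<noteq> M1"
    proof
      assume "M1 ** M2 = M1"
      then have "M1 ** (M1 ** M2) = M1 ** M1" by (rule arg_cong)
      then show False using M1_M2_distinct by simp
    qed
    show "M1 ** M2 \<noteq> M2"
    proof
      assume "M1 ** M2 = M2"
      then have "M2 ** (M1 ** M2) = M2 ** M2" by (rule arg_cong)
      then show False using M1_M2_distinct by simp
    qed
  qed
  note ne = this M1_M2_distinct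
  have "h \<in> hom ?Z (Aut code)"
    unfolding hom_def Z carrier_Aut_code mult
    by (auto simp: h_def integer_mod_group_def simp flip: matrix_mul_assoc)
  moreover have "bij_betw h (carrier ?Z) (carrier (Aut code))"
    unfolding bij_betw_def Z carrier_Aut_code using ne ne[symmetric] by (auto simp: h_def inj_on_def)
  ultimately have "h \<in> iso ?Z (Aut code)"
    by (simp add: iso_def)
  moreover have "group ?Z"
    by (simp add: DirProd_group)
  ultimately show ?thesis
    by (auto simp: is_iso_def intro: group.iso_set_sym)
qed

section \<open>Subspace distance and the lower bound on the code size\<close>

lemma subspace_dist_code:
  assumes "U \<in> code" "W \<in> code" "U \<noteq> W"
  shows "4 \<le> subspace_dist U W"
proof -
  have dims: "vec.subspace U" "vec.dim U = 3" "vec.subspace W" "vec.dim W = 3"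
    using assms code_subset by (auto simp: subspaces_of_dim_def)
  have "U + W = {x + y |x y. x \<in> U \<and> y \<in> W}"
    by (auto simp: set_plus_def)
  \<comment> \<open>The distance is therefore 6 minus twice the dimension of the intersection, which
    is at most 1.\<close>
  then have "vec.dim (U + W) + vec.dim (U \<inter> W) = 6"
    using vec.dim_sums_Int[OF dims(1,3)] dims by simp
  with code_dim_Int[OF assms] show ?thesis
    by (simp add: subspace_dist_def)
qed

lemma max_code_size_ge: "333 \<le> max_code_size TYPE(bit) TYPE(7) 4 3"
  unfolding max_code_size_def
proof (rule Max_ge[OF max_code_size_set_finite_nonempty(1)])
  show "333 \<in> {card C |C :: (bit ^ 7) set set. C \<subseteq> subspaces_of_dim 3 \<and>
      (\<forall>U\<in>C. \<forall>W\<in>C. U \<noteq> W \<longrightarrow> int 4 \<le> subspace_dist U W)}"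
    using card_code code_subset subspace_dist_code by (intro CollectI exI[of _ code]) simp
qed

theorem theorem2:
  shows
    "(\<exists>C :: (bit ^ 7) set set.
        C \<subseteq> subspaces_of_dim 3 \<and> card C = 333 \<and>
        (\<forall>U\<in>C. \<forall>W\<in>C. U \<noteq> W \<longrightarrow> vec.dim (U \<inter> W) \<le> 1))
     \<and> max_code_size TYPE(bit) TYPE(7) 4 3 \<ge> 333
     \<and> {M1, M2} \<subseteq> carrier GL
     \<and> (\<exists>C :: (bit ^ 7) set set.
        C \<subseteq> subspaces_of_dim 3 \<and> card C = 333 \<and>
        (\<forall>U\<in>C. \<forall>W\<in>C. U \<noteq> W \<longrightarrow> vec.dim (U \<inter> W) \<le> 1) \<and>
        Aut C \<cong> integer_mod_group 2 \<times>\<times> integer_mod_group 2 \<and>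
        carrier (Aut C) = generate GL {M1, M2})"
  by (intro conjI exI[of _ code] ballI impI)
    (simp_all add: code_subset card_code code_dim_Int[simplified] max_code_size_ge M1_M2_in_GL Aut_code_iso
      carrier_Aut_code generate_eq)

end
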